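(* Let $n\geq 1$. Every element of $\mathrm{Cong}(\mathcal{P}_n^\Phi)$ is covered by only finitely many elements, but there are elements of $\mathrm{Cong}(\mathcal{P}_n^\Phi)$ that cover infinitely many elements.
   Context: Let $\mathbb{N}=\{0,1,2,\dots\}$ and, for $n\ge 1$, let $[n]=\{1,\dots,n\}$, with disjoint copies $[n]'=\{1',\dots,n'\}$ and $[n]''=\{1'',\dots,n''\}$. The partition monoid $\mathcal{P}_n$ consists of all set partitions of $[n]\cup[n]'$. For $\alpha,\beta\in\mathcal{P}_n$ the product graph $\Gamma(\alpha,\beta)$ has vertex set $[n]\cup[n]''\cup[n]'$; two vertices of $[n]\cup[n]''$ are joined when they lie in a common block of $\alpha$ after renaming each $x'$ of $\alpha$ to $x''$, and two vertices of $[n]''\cup[n]'$ are joined when they lie in a common block of $\beta$ after renaming each $x$ of $\beta$ to $x''$. The product $\alpha\beta\in\mathcal{P}_n$ is the partition in which $x,y\in[n]\cup[n]'$ are in the same block iff they lie in the same connected component of $\Gamma(\alpha,\beta)$. $\Phi(\alpha,\beta)$ is the number of connected components of $\Gamma(\alpha,\beta)$ wholly contained in $[n]''$. The twisted partition monoid is $\mathcal{P}_n^\Phi=\mathbb{N}\times\mathcal{P}_n$ with product $(i,\alpha)(j,\beta)=(i+j+\Phi(\alpha,\beta),\alpha\beta)$. For a monoid $M$, $\mathrm{Cong}(M)$ is the lattice of all congruences on $M$ ordered by inclusion. In a poset, $b$ covers $a$ (equivalently $a$ is covered by $b$) if $a<b$ and there is no $c$ with $a<c<b$. *)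

theory Defs
  imports "HOL-Library.Disjoint_Sets" "HOL-Algebra.Group"
begin

text \<open>
  \<open>Up x\<close>, \<open>Mid x\<close>, \<open>Lo x\<close> stand for $x$, $x''$, $x'$ respectively.
  A partition is its set of blocks.
\<close>

datatype vertex = Up nat | Mid nat | Lo nat

definition boundary :: "nat \<Rightarrow> vertex set" where
  "boundary n = Up ` {1..n} \<union> Lo ` {1..n}"

definition partitions :: "nat \<Rightarrow> vertex set set set" where
  "partitions n = {P. partition_on (boundary n) P}"

fun lo_to_mid :: "vertex \<Rightarrow> vertex" where
  "lo_to_mid (Up x) = Up x"
| "lo_to_mid (Mid x) = Mid x"
| "lo_to_mid (Lo x) = Mid x"

fun up_to_mid :: "vertex \<Rightarrow> vertex" where
  "up_to_mid (Up x) = Mid x"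
| "up_to_mid (Mid x) = Mid x"
| "up_to_mid (Lo x) = Lo x"

text \<open>
  The product graph, with its edges as ordered pairs; the edge relation is symmetric, and
  contains a loop at each vertex, which does not affect the connected components.
\<close>

definition product_vertices :: "nat \<Rightarrow> vertex set" where
  "product_vertices n = Up ` {1..n} \<union> Mid ` {1..n} \<union> Lo ` {1..n}"

definition product_edges :: "vertex set set \<Rightarrow> vertex set set \<Rightarrow> vertex rel" where
  "product_edges \<alpha> \<beta> =
     {(lo_to_mid x, lo_to_mid y) | x y. \<exists>B\<in>\<alpha>. x \<in> B \<and> y \<in> B} \<union>
     {(up_to_mid x, up_to_mid y) | x y. \<exists>B\<in>\<beta>. x \<in> B \<and> y \<in> B}"

definition product_components ::
    "nat \<Rightarrow> vertex set set \<Rightarrow> vertex set set \<Rightarrow> vertex set set" where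
  "product_components n \<alpha> \<beta> =
     product_vertices n // ((product_edges \<alpha> \<beta>)\<^sup>* \<inter> product_vertices n \<times> product_vertices n)"

definition partition_prod ::
    "nat \<Rightarrow> vertex set set \<Rightarrow> vertex set set \<Rightarrow> vertex set set" where
  "partition_prod n \<alpha> \<beta> = {C \<inter> boundary n | C. C \<in> product_components n \<alpha> \<beta>} - {{}}"

definition Phi :: "nat \<Rightarrow> vertex set set \<Rightarrow> vertex set set \<Rightarrow> nat" where
  "Phi n \<alpha> \<beta> = card {C \<in> product_components n \<alpha> \<beta>. C \<subseteq> Mid ` {1..n}}"

definition partition_one :: "nat \<Rightarrow> vertex set set" where
  "partition_one n = {{Up x, Lo x} | x. x \<in> {1..n}}"

definition twisted_partition_monoid :: "nat \<Rightarrow> (nat \<times> vertex set set) monoid" where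
  "twisted_partition_monoid n =
     \<lparr>carrier = UNIV \<times> partitions n,
      mult = (\<lambda>(i, \<alpha>) (j, \<beta>). (i + j + Phi n \<alpha> \<beta>, partition_prod n \<alpha> \<beta>)),
      one = (0, partition_one n)\<rparr>"

definition Cong :: "('a, 'b) monoid_scheme \<Rightarrow> 'a rel set" where
  "Cong M = {r. equiv (carrier M) r \<and>
     (\<forall>a b c d. (a, b) \<in> r \<longrightarrow> (c, d) \<in> r \<longrightarrow> (a \<otimes>\<^bsub>M\<^esub> c, b \<otimes>\<^bsub>M\<^esub> d) \<in> r)}"

text \<open>\<open>covers S b a\<close>: in the poset \<open>S\<close> with the order of its type, \<open>b\<close> covers \<open>a\<close>.\<close>

definition covers :: "'a::order set \<Rightarrow> 'a \<Rightarrow> 'a \<Rightarrow> bool" where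
  "covers S b a \<longleftrightarrow> a \<in> S \<and> b \<in> S \<and> a < b \<and> \<not> (\<exists>c\<in>S. a < c \<and> c < b)"

lemma sym_product_edges: "sym (product_edges \<alpha> \<beta>)"
  unfolding product_edges_def sym_def by blast

lemma equiv_product_connected:
  "equiv (product_vertices n)
     ((product_edges \<alpha> \<beta>)\<^sup>* \<inter> product_vertices n \<times> product_vertices n)"
proof (rule equivI)
  show "sym ((product_edges \<alpha> \<beta>)\<^sup>* \<inter> product_vertices n \<times> product_vertices n)"
    by (intro sym_Int sym_rtrancl sym_product_edges) (auto simp: sym_def)
  show "trans ((product_edges \<alpha> \<beta>)\<^sup>* \<inter> product_vertices n \<times> product_vertices n)"
    by (intro trans_Int trans_rtrancl) (auto simp: trans_def)
qed (auto simp: refl_on_def)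

lemma boundary_subset: "boundary n \<subseteq> product_vertices n"
  by (auto simp: boundary_def product_vertices_def)

lemma partition_prod_closed: "partition_prod n \<alpha> \<beta> \<in> partitions n"
proof -
  have "partition_on (boundary n \<inter> product_vertices n)
          ((\<inter>) (boundary n) ` product_components n \<alpha> \<beta> - {{}})"
    unfolding product_components_def
    by (intro partition_on_restrict partition_on_quotient equiv_product_connected)
  moreover have "(\<inter>) (boundary n) ` product_components n \<alpha> \<beta> - {{}} = partition_prod n \<alpha> \<beta>"
    by (auto simp: partition_prod_def Int_commute)
  ultimately show ?thesis
    using boundary_subset[of n] by (simp add: partitions_def Int_absorb2)
qed

lemma partition_prod_same_block_iff:
  assumes "x \<in> boundary n" "y \<in> boundary n"
  shows "(\<exists>B\<in>partition_prod n \<alpha> \<beta>. x \<in> B \<and> y \<in> B) \<longleftrightarrow> (x, y) \<in> (product_edges \<alpha> \<beta>)\<^sup>*"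
proof
  assume "\<exists>B\<in>partition_prod n \<alpha> \<beta>. x \<in> B \<and> y \<in> B"
  then obtain C where C: "C \<in> product_components n \<alpha> \<beta>" "x \<in> C" "y \<in> C"
    unfolding partition_prod_def by blast
  show "(x, y) \<in> (product_edges \<alpha> \<beta>)\<^sup>*"
    using in_quotient_imp_in_rel[OF equiv_product_connected C(1)[unfolded product_components_def], of x y]
      C(2,3) by blast
next
  assume xy: "(x, y) \<in> (product_edges \<alpha> \<beta>)\<^sup>*"
  define R where "R = (product_edges \<alpha> \<beta>)\<^sup>* \<inter> product_vertices n \<times> product_vertices n"
  have V: "x \<in> product_vertices n" "y \<in> product_vertices n"
    using assms boundary_subset by blast+
  have "R `` {x} \<in> product_components n \<alpha> \<beta>"
    unfolding product_components_def R_def by (rule quotientI[OF V(1)])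
  moreover have "x \<in> R `` {x}" "y \<in> R `` {x}"
    using xy V unfolding R_def by blast+
  ultimately have "R `` {x} \<inter> boundary n \<in> partition_prod n \<alpha> \<beta>"
    using assms unfolding partition_prod_def by blast
  moreover have "x \<in> R `` {x} \<inter> boundary n \<and> y \<in> R `` {x} \<inter> boundary n"
    using \<open>x \<in> R `` {x}\<close> \<open>y \<in> R `` {x}\<close> assms by (simp only: Int_iff simp_thms)
  ultimately show "\<exists>B\<in>partition_prod n \<alpha> \<beta>. x \<in> B \<and> y \<in> B"
    by (rule bexI[rotated])
qed

end

theory Submission
  imports Defs "HOL-Library.Infinite_Set" "HOL-Number_Theory.Cong"
begin

text \<open>
  The element \<open>(1, id)\<close> is central and acts by shifting the first coordinate, so the monoid is a
  free \<open>\<nat>\<close>-act of finite rank. Two distinct covers of a congruence \<open>\<sigma>\<close> intersect in \<open>\<sigma>\<close>, so it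
  suffices to find in every cover \<open>\<tau>\<close> a pair outside \<open>\<sigma>\<close> coming from a set that is finite up to \<open>\<sigma>\<close>.
  Call \<open>\<alpha>\<close> periodic if \<open>\<sigma>\<close> identifies two elements of \<open>\<nat> \<times> {\<alpha>}\<close>; then \<open>\<nat> \<times> {\<alpha>}\<close> meets finitely
  many \<open>\<sigma>\<close>-classes. If shifting some pair of \<open>\<tau> - \<sigma>\<close> eventually leads into \<open>\<sigma>\<close>, the last pair outside
  \<open>\<sigma>\<close> either is periodic or is determined by its second coordinates. Otherwise, for every \<open>k\<close>,
  let \<open>I\<close> be the \<open>\<sigma>\<close>-saturation of the \<open>k\<close>-fold shift of the monoid; the
  congruence \<open>\<sigma> \<union> (\<tau> \<inter> I \<times> I)\<close> must be \<open>\<tau>\<close>, and by the pigeonhole principle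
  all pairs in \<open>\<tau> - \<sigma>\<close> are periodic.

  For the second claim, let \<open>\<theta>\<^sub>d\<close> identify \<open>(i, \<alpha>)\<close> with \<open>(j, \<alpha>)\<close> when \<open>\<alpha>\<close> has no transversal and
  \<open>i \<equiv> j\<close> modulo \<open>d\<close>. Any two partitions without transversals satisfy \<open>\<beta>\<alpha>\<beta> = \<beta>\<close>, whence \<open>\<theta>\<^sub>1\<close>
  covers \<open>\<theta>\<^sub>p\<close> for every prime \<open>p\<close>.
\<close>

section \<open>The partition monoid\<close>

definition same_block :: "'a set set \<Rightarrow> 'a \<Rightarrow> 'a \<Rightarrow> bool" where
  "same_block P x y \<longleftrightarrow> (\<exists>B\<in>P. x \<in> B \<and> y \<in> B)"

lemma same_block_sym: "same_block P x y \<Longrightarrow> same_block P y x"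
  by (auto simp: same_block_def)

lemma same_block_in: "P \<in> partitions n \<Longrightarrow> same_block P x y \<Longrightarrow> x \<in> boundary n \<and> y \<in> boundary n"
  by (auto simp: same_block_def partitions_def partition_on_def)

lemma same_block_refl: "P \<in> partitions n \<Longrightarrow> x \<in> boundary n \<Longrightarrow> same_block P x x"
  by (auto simp: same_block_def partitions_def partition_on_def)

lemma same_block_trans:
  assumes "P \<in> partitions n" "same_block P x y" "same_block P y z"
  shows "same_block P x z"
  using assms unfolding same_block_def partitions_def partition_on_def disjoint_def by blast

text \<open>In any partition the block through \<open>x\<close> consists of all points in the same
  block as \<open>x\<close>, so it can be recovered from \<open>same_block\<close>. The inclusion is
  used in both directions in \<open>partitions_eqI\<close>.\<close>

lemma partition_on_subset_if_same_block:
  assumes P: "partition_on A P" and Q: "partition_on A Q"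
    and eq: "\<And>x y. x \<in> A \<Longrightarrow> y \<in> A \<Longrightarrow> same_block P x y \<longleftrightarrow> same_block Q x y"
  shows "P \<subseteq> Q"
proof
  fix B assume B: "B \<in> P"
  then obtain x where x: "x \<in> B"
    using P by (metis all_not_in_conv partition_onD3)
  then have "x \<in> A"
    using B P by (auto simp: partition_on_def)
  then obtain C where C: "C \<in> Q" "x \<in> C"
    using Q by (auto simp: partition_on_def)
  have sub: "B \<subseteq> A" "C \<subseteq> A"
    using B C P Q by (auto simp: partition_on_def)
  have "y \<in> B \<longleftrightarrow> same_block P x y" if "y \<in> A" for y
    using B x P unfolding same_block_def partition_on_def disjoint_def by blast
  moreover have "y \<in> C \<longleftrightarrow> same_block Q x y" if "y \<in> A" for y
    using C Q unfolding same_block_def partition_on_def disjoint_def by blast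
  ultimately have "B = C"
    using eq \<open>x \<in> A\<close> sub by blast
  then show "B \<in> Q"
    using C by simp
qed

lemma partitions_eqI:
  assumes "P \<in> partitions n" "Q \<in> partitions n"
    and "\<And>x y. x \<in> boundary n \<Longrightarrow> y \<in> boundary n \<Longrightarrow> same_block P x y \<longleftrightarrow> same_block Q x y"
  shows "P = Q"
  using partition_on_subset_if_same_block[of "boundary n" P Q]
    partition_on_subset_if_same_block[of "boundary n" Q P] assms
  unfolding partitions_def by blast

lemma finite_partitions: "finite (partitions n)"
  unfolding partitions_def by (rule finitely_many_partition_on) (simp add: boundary_def)

lemma same_block_prod:
  "x \<in> boundary n \<Longrightarrow> y \<in> boundary n \<Longrightarrow>
    same_block (partition_prod n \<alpha> \<beta>) x y \<longleftrightarrow> (x, y) \<in> (product_edges \<alpha> \<beta>)\<^sup>*"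
  using partition_prod_same_block_iff unfolding same_block_def .

lemma product_edgesE:
  assumes "(u, v) \<in> product_edges \<alpha> \<beta>"
  obtains x y where "u = lo_to_mid x" "v = lo_to_mid y" "same_block \<alpha> x y"
    | x y where "u = up_to_mid x" "v = up_to_mid y" "same_block \<beta> x y"
  using assms unfolding product_edges_def same_block_def by blast

lemma product_edges_left:
  "same_block \<alpha> x y \<Longrightarrow> (lo_to_mid x, lo_to_mid y) \<in> product_edges \<alpha> \<beta>"
  unfolding product_edges_def same_block_def by blast

lemma product_edges_right:
  "same_block \<beta> x y \<Longrightarrow> (up_to_mid x, up_to_mid y) \<in> product_edges \<alpha> \<beta>"
  unfolding product_edges_def same_block_def by blast

lemma partition_one_closed: "partition_one n \<in> partitions n"
  unfolding partitions_def partition_on_def partition_one_def boundary_def disjoint_def by (auto, blast+)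

lemma same_block_one:
  "same_block (partition_one n) x y \<Longrightarrow>
    \<exists>k. x \<in> {Up k, Lo k} \<and> y \<in> {Up k, Lo k}"
  unfolding same_block_def partition_one_def by blast

lemma product_edges_one:
  assumes "k \<in> {1..n}"
  shows "(Up k, Mid k) \<in> product_edges (partition_one n) \<alpha>"
    "(Mid k, Up k) \<in> product_edges (partition_one n) \<alpha>"
proof -
  have "same_block (partition_one n) (Up k) (Lo k)"
    using assms unfolding same_block_def partition_one_def by blast
  from product_edges_left[OF this] product_edges_left[OF same_block_sym[OF this]]
  show "(Up k, Mid k) \<in> product_edges (partition_one n) \<alpha>"
    "(Mid k, Up k) \<in> product_edges (partition_one n) \<alpha>"
    by simp_all
qed

text \<open>Contracts the edges contributed by \<open>partition_one\<close> when it is the left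
  factor: each middle vertex is merged with the upper vertex above it.\<close>

fun mid_to_up :: "vertex \<Rightarrow> vertex" where
  "mid_to_up (Up x) = Up x"
| "mid_to_up (Mid x) = Up x"
| "mid_to_up (Lo x) = Lo x"

lemma boundary_cases:
  assumes "x \<in> boundary n"
  obtains k where "x = Up k" "k \<in> {1..n}" | k where "x = Lo k" "k \<in> {1..n}"
  using assms unfolding boundary_def by blast

text \<open>Under \<open>mid_to_up\<close>, the edges from the identity collapse to points, while
  the edges from \<alpha> become pairs inside blocks of \<alpha>; hence paths of the product graph
  map into single blocks of \<alpha>.\<close>

lemma partition_one_prod:
  assumes "\<alpha> \<in> partitions n"
  shows "partition_prod n (partition_one n) \<alpha> = \<alpha>"
proof (rule partitions_eqI[OF partition_prod_closed assms])
  fix x y assume xy: "x \<in> boundary n" "y \<in> boundary n"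
  let ?E = "product_edges (partition_one n) \<alpha>"
  have fixed: "mid_to_up z = z" if "z \<in> boundary n" for z
    using that by (auto elim: boundary_cases)
  have step: "mid_to_up u = mid_to_up v \<or> same_block \<alpha> (mid_to_up u) (mid_to_up v)"
    if "(u, v) \<in> ?E" for u v
    using that
  proof (cases rule: product_edgesE)
    case (1 x y)
    then show ?thesis
      using same_block_one[OF 1(3)] by auto
  next
    case (2 x y)
    then have "x \<in> boundary n" "y \<in> boundary n"
      using same_block_in[OF assms] by blast+
    then have "mid_to_up (up_to_mid x) = x" "mid_to_up (up_to_mid y) = y"
      by (auto elim: boundary_cases)
    then show ?thesis
      using 2 by simp
  qed
  have "mid_to_up u = mid_to_up v \<or> same_block \<alpha> (mid_to_up u) (mid_to_up v)"
    if "(u, v) \<in> ?E\<^sup>*" for u v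
    using that
  proof induction
    case (step v w)
    then show ?case
      using \<open>\<And>u v. (u, v) \<in> ?E \<Longrightarrow> _\<close>[of v w] same_block_trans[OF assms] by metis
  qed simp
  from this[of x y] have "(x, y) \<in> ?E\<^sup>* \<Longrightarrow> same_block \<alpha> x y"
    using fixed xy same_block_refl[OF assms xy(1)] by auto
  moreover have "(x, y) \<in> ?E\<^sup>*" if "same_block \<alpha> x y"
  proof -
    \<comment> \<open>An upper vertex reaches its middle copy through an edge of the identity; a
      lower vertex is fixed by \<open>up_to_mid\<close>.\<close>
    have up: "(z, up_to_mid z) \<in> ?E\<^sup>*" "(up_to_mid z, z) \<in> ?E\<^sup>*" if "z \<in> boundary n" for z
      using that product_edges_one[of _ n \<alpha>] by (auto elim!: boundary_cases)
    show ?thesis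
      using up(1)[OF xy(1)] product_edges_right[OF that, of "partition_one n"] up(2)[OF xy(2)]
      by (meson rtrancl.rtrancl_into_rtrancl rtrancl_trans)
  qed
  ultimately show "same_block (partition_prod n (partition_one n) \<alpha>) x y \<longleftrightarrow> same_block \<alpha> x y"
    using same_block_prod[OF xy] by blast
qed

text \<open>Every middle vertex is adjacent to the upper vertex above it, so no component stays in
  the middle row.\<close>

lemma Phi_one: "Phi n (partition_one n) \<alpha> = 0"
proof -
  let ?R = "(product_edges (partition_one n) \<alpha>)\<^sup>* \<inter> product_vertices n \<times> product_vertices n"
  have False if C: "C \<in> product_components n (partition_one n) \<alpha>" "C \<subseteq> Mid ` {1..n}" for C
  proof -
    obtain v where v: "v \<in> product_vertices n" "C = ?R `` {v}"
      using C(1) unfolding product_components_def quotient_def by blast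
    then have "v \<in> C"
      by auto
    then obtain k where k: "v = Mid k" "k \<in> {1..n}"
      using C(2) by blast
    then have "Up k \<in> C"
      using v product_edges_one(2)[OF k(2)] by (auto simp: product_vertices_def)
    then show False
      using C(2) by blast
  qed
  then have "{C \<in> product_components n (partition_one n) \<alpha>. C \<subseteq> Mid ` {1..n}} = {}"
    by blast
  then show ?thesis
    unfolding Phi_def by simp
qed

section \<open>Congruences of the twisted partition monoid\<close>

lemma carrier_twisted: "(i, \<alpha>) \<in> carrier (twisted_partition_monoid n) \<longleftrightarrow> \<alpha> \<in> partitions n"
  by (simp add: twisted_partition_monoid_def)

lemma mult_twisted:
  "(i, \<alpha>) \<otimes>\<^bsub>twisted_partition_monoid n\<^esub> (j, \<beta>) = (i + j + Phi n \<alpha> \<beta>, partition_prod n \<alpha> \<beta>)"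
  by (simp add: twisted_partition_monoid_def)

lemma Cong_Int: "\<sigma> \<in> Cong M \<Longrightarrow> \<tau> \<in> Cong M \<Longrightarrow> \<sigma> \<inter> \<tau> \<in> Cong M"
  unfolding Cong_def equiv_def refl_on_def by (auto intro: sym_Int trans_Int)

lemma Cong_sym: "\<sigma> \<in> Cong M \<Longrightarrow> (a, b) \<in> \<sigma> \<Longrightarrow> (b, a) \<in> \<sigma>"
  unfolding Cong_def equiv_def sym_def by blast

lemma Cong_trans: "\<sigma> \<in> Cong M \<Longrightarrow> (a, b) \<in> \<sigma> \<Longrightarrow> (b, c) \<in> \<sigma> \<Longrightarrow> (a, c) \<in> \<sigma>"
  unfolding Cong_def equiv_def trans_def by blast

lemma Cong_refl: "\<sigma> \<in> Cong M \<Longrightarrow> a \<in> carrier M \<Longrightarrow> (a, a) \<in> \<sigma>"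
  unfolding Cong_def equiv_def refl_on_def by blast

lemma Cong_carrier: "\<sigma> \<in> Cong M \<Longrightarrow> (a, b) \<in> \<sigma> \<Longrightarrow> a \<in> carrier M \<and> b \<in> carrier M"
  unfolding Cong_def equiv_def refl_on_def by blast

lemma Cong_mult:
  "\<sigma> \<in> Cong M \<Longrightarrow> (a, b) \<in> \<sigma> \<Longrightarrow> (c, d) \<in> \<sigma> \<Longrightarrow> (a \<otimes>\<^bsub>M\<^esub> c, b \<otimes>\<^bsub>M\<^esub> d) \<in> \<sigma>"
  unfolding Cong_def by blast

text \<open>Left multiplication by \<open>(k, partition_one n)\<close> adds \<open>k\<close> to the
  first coordinate and fixes the second.\<close>

lemma Cong_shift:
  assumes "\<sigma> \<in> Cong (twisted_partition_monoid n)" "((i, \<alpha>), (j, \<beta>)) \<in> \<sigma>"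
  shows "((i + k, \<alpha>), (j + k, \<beta>)) \<in> \<sigma>"
proof -
  let ?M = "twisted_partition_monoid n"
  have "((k, partition_one n), (k, partition_one n)) \<in> \<sigma>"
    using Cong_refl[OF assms(1)] by (simp add: carrier_twisted partition_one_closed)
  then have "((k, partition_one n) \<otimes>\<^bsub>?M\<^esub> (i, \<alpha>), (k, partition_one n) \<otimes>\<^bsub>?M\<^esub> (j, \<beta>)) \<in> \<sigma>"
    using Cong_mult assms by metis
  moreover have "\<alpha> \<in> partitions n" "\<beta> \<in> partitions n"
    using Cong_carrier[OF assms] by (simp_all add: carrier_twisted)
  ultimately show ?thesis
    by (simp add: mult_twisted partition_one_prod Phi_one add.commute)
qed

text \<open>The pair \<open>x\<close> puts \<tau> \<inter> \<tau>' strictly above \<sigma>; since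
  nothing lies strictly between \<sigma> and either cover, the intersection equals both.\<close>

lemma covers_Cong_unique:
  assumes "covers (Cong M) \<tau> \<sigma>" "covers (Cong M) \<tau>' \<sigma>" "x \<in> \<tau>" "x \<in> \<tau>'" "x \<notin> \<sigma>"
  shows "\<tau> = \<tau>'"
proof -
  have c: "\<tau> \<in> Cong M" "\<sigma> < \<tau>" "\<And>\<rho>. \<rho> \<in> Cong M \<Longrightarrow> \<sigma> < \<rho> \<Longrightarrow> \<not> \<rho> < \<tau>"
    using assms(1) by (auto simp: covers_def)
  have c': "\<tau>' \<in> Cong M" "\<sigma> < \<tau>'" "\<And>\<rho>. \<rho> \<in> Cong M \<Longrightarrow> \<sigma> < \<rho> \<Longrightarrow> \<not> \<rho> < \<tau>'"
    using assms(2) by (auto simp: covers_def)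
  have I: "\<tau> \<inter> \<tau>' \<in> Cong M"
    using Cong_Int c(1) c'(1) .
  have "\<sigma> \<subseteq> \<tau> \<inter> \<tau>'" "x \<in> \<tau> \<inter> \<tau>'"
    using c(2) c'(2) assms(3,4) by auto
  then have "\<sigma> < \<tau> \<inter> \<tau>'"
    using assms(5) by blast
  then have "\<tau> \<inter> \<tau>' = \<tau>" "\<tau> \<inter> \<tau>' = \<tau>'"
    using c(3)[OF I] c'(3)[OF I] by (meson Int_lower1 Int_lower2 psubsetI)+
  then show ?thesis
    by simp
qed

section \<open>Periodicity and finiteness up to a congruence\<close>

definition periodic :: "(nat \<times> 'a) rel \<Rightarrow> 'a \<Rightarrow> bool" where
  "periodic \<sigma> \<alpha> \<longleftrightarrow> (\<exists>p q. p < q \<and> ((p, \<alpha>), (q, \<alpha>)) \<in> \<sigma>)"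

lemma periodicI:
  assumes "\<sigma> \<in> Cong M" "((p, \<alpha>), (q, \<alpha>)) \<in> \<sigma>" "p \<noteq> q"
  shows "periodic \<sigma> \<alpha>"
  using assms Cong_sym[OF assms(1,2)] unfolding periodic_def by (meson linorder_neqE_nat)

text \<open>The period is carried along the chain \<open>(j + p, \<beta>)\<close>,
  \<open>(i + p, \<alpha>)\<close>, \<open>(i + q, \<alpha>)\<close>,
  \<open>(j + q, \<beta>)\<close> of \<sigma>-related elements.\<close>

lemma periodic_transfer:
  assumes \<sigma>: "\<sigma> \<in> Cong (twisted_partition_monoid n)"
    and r: "((i, \<alpha>), (j, \<beta>)) \<in> \<sigma>" and "periodic \<sigma> \<alpha>"
  shows "periodic \<sigma> \<beta>"
proof -
  obtain p q where pq: "p < q" "((p, \<alpha>), (q, \<alpha>)) \<in> \<sigma>"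
    using assms(3) unfolding periodic_def by blast
  have "((j + p, \<beta>), (i + p, \<alpha>)) \<in> \<sigma>"
    using Cong_shift[OF \<sigma> Cong_sym[OF \<sigma> r]] .
  moreover have "((i + p, \<alpha>), (i + q, \<alpha>)) \<in> \<sigma>"
    using Cong_shift[OF \<sigma> pq(2), of i] by (simp add: add.commute)
  moreover have "((i + q, \<alpha>), (j + q, \<beta>)) \<in> \<sigma>"
    using Cong_shift[OF \<sigma> r] .
  ultimately have "((j + p, \<beta>), (j + q, \<beta>)) \<in> \<sigma>"
    using Cong_trans[OF \<sigma>] by blast
  then show ?thesis
    using periodicI[OF \<sigma>] pq(1) by simp
qed

text \<open>If \<open>p < q\<close> are related over \<alpha>, an index \<open>i\<close> with
  \<open>i \<ge> q\<close> can be lowered to \<open>p + (i - q)\<close>, so the indices below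
  \<open>q\<close> represent all classes over \<alpha>.\<close>

lemma finite_periodic_classes:
  assumes \<sigma>: "\<sigma> \<in> Cong (twisted_partition_monoid n)"
  shows "finite {\<sigma> `` {(i, \<alpha>)} | i \<alpha>. \<alpha> \<in> partitions n \<and> periodic \<sigma> \<alpha>}" (is "finite ?C")
proof -
  have "finite {\<sigma> `` {(i, \<alpha>)} | i. True}" if per: "periodic \<sigma> \<alpha>" for \<alpha>
  proof -
    obtain p q where pq: "p < q" "((p, \<alpha>), (q, \<alpha>)) \<in> \<sigma>"
      using per unfolding periodic_def by blast
    have "\<exists>j<q. \<sigma> `` {(i, \<alpha>)} = \<sigma> `` {(j, \<alpha>)}" for i
    proof (induction i rule: less_induct)
      case (less i)
      show ?case
      proof (cases "i < q")
        case False
        have "((p + (i - q), \<alpha>), (i, \<alpha>)) \<in> \<sigma>"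
          using Cong_shift[OF \<sigma> pq(2), of "i - q"] False by simp
        then have "\<sigma> `` {(p + (i - q), \<alpha>)} = \<sigma> `` {(i, \<alpha>)}"
          using \<sigma> equiv_class_eq unfolding Cong_def by fast
        moreover have "p + (i - q) < i"
          using pq(1) False by simp
        ultimately show ?thesis
          using less by metis
      qed blast
    qed
    then have "{\<sigma> `` {(i, \<alpha>)} | i. True} \<subseteq> (\<lambda>j. \<sigma> `` {(j, \<alpha>)}) ` {..<q}"
      by blast
    then show ?thesis
      by (rule finite_subset) simp
  qed
  moreover have "?C = (\<Union>\<alpha>\<in>{\<alpha> \<in> partitions n. periodic \<sigma> \<alpha>}. {\<sigma> `` {(i, \<alpha>)} | i. True})"
    by blast
  ultimately show ?thesis
    using finite_partitions[of n] by simp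
qed

text \<open>The pairs outside \<sigma> that enter it after one shift. Non-periodicity is stated for
  \<alpha>; it passes to \<beta> by \<open>periodic_transfer\<close>.\<close>

definition last_pairs :: "(nat \<times> 'a) rel \<Rightarrow> (nat \<times> 'a) rel" where
  "last_pairs \<sigma> = {((i, \<alpha>), (j, \<beta>)) | i j \<alpha> \<beta>.
     ((i, \<alpha>), (j, \<beta>)) \<notin> \<sigma> \<and> ((Suc i, \<alpha>), (Suc j, \<beta>)) \<in> \<sigma> \<and> \<not> periodic \<sigma> \<alpha>}"

text \<open>The two partitions determine the pair. Different values of \<open>i - j\<close> would
  give \<alpha> a period; with equal values, the pair with larger indices is a proper shift of the
  other and would already lie in \<sigma>.\<close>

lemma finite_last_pairs:
  assumes \<sigma>: "\<sigma> \<in> Cong (twisted_partition_monoid n)"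
  shows "finite (last_pairs \<sigma>)"
proof (rule inj_on_finite)
  have lt: False if 1: "((Suc i, \<alpha>), (Suc j, \<beta>)) \<in> \<sigma>" and 2: "((i', \<alpha>), (j', \<beta>)) \<notin> \<sigma>"
    and "i + j' = i' + j" "i < i'" for i j i' j' \<alpha> \<beta>
  proof -
    have "Suc i + (i' - Suc i) = i'" "Suc j + (i' - Suc i) = j'"
      using that by simp_all
    then show False
      using Cong_shift[OF \<sigma> 1, of "i' - Suc i"] 2 by simp
  qed
  show "inj_on (map_prod snd snd) (last_pairs \<sigma>)"
  proof (rule inj_onI)
    fix x y assume x: "x \<in> last_pairs \<sigma>" and y: "y \<in> last_pairs \<sigma>"
      and eq: "map_prod snd snd x = map_prod snd snd y"
    obtain i j \<alpha> \<beta> where x': "x = ((i, \<alpha>), (j, \<beta>))" "((i, \<alpha>), (j, \<beta>)) \<notin> \<sigma>"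
      "((Suc i, \<alpha>), (Suc j, \<beta>)) \<in> \<sigma>" "\<not> periodic \<sigma> \<alpha>"
      using x unfolding last_pairs_def by blast
    obtain i' j' where y': "y = ((i', \<alpha>), (j', \<beta>))" "((i', \<alpha>), (j', \<beta>)) \<notin> \<sigma>"
      "((Suc i', \<alpha>), (Suc j', \<beta>)) \<in> \<sigma>"
      using y eq unfolding last_pairs_def x' by auto
    \<comment> \<open>The shifts are chosen so that the two entries over \<beta> coincide; what
      remains relates two indices over \<alpha>, which must be equal.\<close>
    have "((Suc i + j', \<alpha>), (Suc j + j', \<beta>)) \<in> \<sigma>" "((Suc j' + j, \<beta>), (Suc i' + j, \<alpha>)) \<in> \<sigma>"
      using Cong_shift[OF \<sigma> x'(3)] Cong_shift[OF \<sigma> Cong_sym[OF \<sigma> y'(3)]] by blast+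
    moreover have "Suc j + j' = Suc j' + j"
      by simp
    ultimately have "((Suc i + j', \<alpha>), (Suc i' + j, \<alpha>)) \<in> \<sigma>"
      using Cong_trans[OF \<sigma>] by metis
    then have d: "i + j' = i' + j"
      using periodicI[OF \<sigma>] x'(4) by (metis add_Suc nat.inject)
    have "\<not> i < i'" "\<not> i' < i"
      using lt[OF x'(3) y'(2)] lt[OF y'(3) x'(2)] d by auto
    then show "x = y"
      using d unfolding x' y' by simp
  qed
  show "map_prod snd snd ` last_pairs \<sigma> \<subseteq> partitions n \<times> partitions n"
    using Cong_carrier[OF \<sigma>] unfolding last_pairs_def by (fastforce simp: carrier_twisted)
  show "finite (partitions n \<times> partitions n)"
    using finite_partitions by blast
qed

text \<open>A Rees-type construction relative to \<sigma>. Saturation keeps a \<sigma>-step from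
  leaving \<open>I\<close>, which gives transitivity; the ideal property gives compatibility with
  products.\<close>

lemma cong_on_ideal:
  assumes \<sigma>: "\<sigma> \<in> Cong M" and \<tau>: "\<tau> \<in> Cong M" and sub: "\<sigma> \<subseteq> \<tau>"
    and sat: "\<And>a b. (a, b) \<in> \<sigma> \<Longrightarrow> a \<in> I \<Longrightarrow> b \<in> I"
    and ideal: "\<And>a c. a \<in> I \<Longrightarrow> c \<in> carrier M \<Longrightarrow> a \<otimes>\<^bsub>M\<^esub> c \<in> I \<and> c \<otimes>\<^bsub>M\<^esub> a \<in> I"
  shows "\<sigma> \<union> (\<tau> \<inter> I \<times> I) \<in> Cong M" (is "?\<rho> \<in> _")
proof -
  have "equiv (carrier M) ?\<rho>"
  proof (rule equivI)
    show "?\<rho> \<subseteq> carrier M \<times> carrier M"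
      using Cong_carrier[OF \<sigma>] Cong_carrier[OF \<tau>] by auto
    show "refl_on (carrier M) ?\<rho>"
      using Cong_refl[OF \<sigma>] by (auto simp: refl_on_def)
    show "sym ?\<rho>"
      using Cong_sym[OF \<sigma>] Cong_sym[OF \<tau>] by (auto simp: sym_def)
    show "trans ?\<rho>"
    proof (rule transI)
      fix a b c assume ab: "(a, b) \<in> ?\<rho>" and bc: "(b, c) \<in> ?\<rho>"
      have "(a, c) \<in> \<tau>"
        using ab bc sub Cong_trans[OF \<tau>] by blast
      then show "(a, c) \<in> ?\<rho>"
        using ab bc sat Cong_trans[OF \<sigma>] Cong_sym[OF \<sigma>] by blast
    qed
  qed
  moreover have "(a \<otimes>\<^bsub>M\<^esub> c, b \<otimes>\<^bsub>M\<^esub> d) \<in> ?\<rho>"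
    if ab: "(a, b) \<in> ?\<rho>" and cd: "(c, d) \<in> ?\<rho>" for a b c d
  proof -
    have "(a \<otimes>\<^bsub>M\<^esub> c, b \<otimes>\<^bsub>M\<^esub> d) \<in> \<tau>"
      using ab cd sub Cong_mult[OF \<tau>] by blast
    moreover have "a \<in> carrier M" "b \<in> carrier M" "c \<in> carrier M" "d \<in> carrier M"
      using ab cd sub Cong_carrier[OF \<tau>] by blast+
    ultimately show ?thesis
      using ab cd Cong_mult[OF \<sigma>] ideal by blast
  qed
  ultimately show ?thesis
    unfolding Cong_def by blast
qed

text \<open>Either alternative leaves finitely many candidates up to \<sigma>, by
  \<open>finite_last_pairs\<close> and \<open>finite_periodic_classes\<close>.\<close>

lemma cover_pair:
  assumes cov: "covers (Cong (twisted_partition_monoid n)) \<tau> \<sigma>"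
  shows "\<exists>a b. (a, b) \<in> \<tau> \<and> (a, b) \<notin> \<sigma> \<and>
    ((a, b) \<in> last_pairs \<sigma> \<or> (periodic \<sigma> (snd a) \<and> periodic \<sigma> (snd b)))"
proof -
  let ?M = "twisted_partition_monoid n"
  have \<sigma>: "\<sigma> \<in> Cong ?M" and \<tau>: "\<tau> \<in> Cong ?M" and sub: "\<sigma> \<subseteq> \<tau>"
    using cov unfolding covers_def by auto
  obtain i \<alpha> j \<beta> where ab: "((i, \<alpha>), (j, \<beta>)) \<in> \<tau>" "((i, \<alpha>), (j, \<beta>)) \<notin> \<sigma>"
    using cov unfolding covers_def by auto
  show ?thesis
  proof (cases "\<exists>k. ((i + k, \<alpha>), (j + k, \<beta>)) \<in> \<sigma>")
    case True
    \<comment> \<open>The first shift that enters \<sigma>. It is positive because the unshifted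
      pair is outside, so its predecessor \<open>l\<close> gives the last pair outside.\<close>
    define k where "k = (LEAST k. ((i + k, \<alpha>), (j + k, \<beta>)) \<in> \<sigma>)"
    have k: "((i + k, \<alpha>), (j + k, \<beta>)) \<in> \<sigma>"
      using True unfolding k_def by (rule LeastI_ex)
    then obtain l where l: "k = Suc l"
      using ab(2) by (cases k) auto
    have "((i + l, \<alpha>), (j + l, \<beta>)) \<notin> \<sigma>"
      using not_less_Least[of l "\<lambda>k. ((i + k, \<alpha>), (j + k, \<beta>)) \<in> \<sigma>"] l unfolding k_def by simp
    moreover have "((i + l, \<alpha>), (j + l, \<beta>)) \<in> \<tau>"
      using Cong_shift[OF \<tau> ab(1)] .
    moreover have "periodic \<sigma> \<beta>" if "periodic \<sigma> \<alpha>"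
      using periodic_transfer[OF \<sigma> k that] .
    moreover have "((i + l, \<alpha>), (j + l, \<beta>)) \<in> last_pairs \<sigma>" if "\<not> periodic \<sigma> \<alpha>"
      using k calculation that unfolding last_pairs_def l by auto
    ultimately show ?thesis
      by (metis snd_conv)
  next
    case False
    \<comment> \<open>Writing \<open>m + k\<close> expresses that the first coordinate is at least
      \<open>k\<close>, a condition preserved by products since they only add to it.\<close>
    define I where "I k = {a. \<exists>m \<gamma>. (a, (m + k, \<gamma>)) \<in> \<sigma>}" for k
    have whole: "\<sigma> \<union> (\<tau> \<inter> I k \<times> I k) = \<tau>" for k
    proof -
      have "\<sigma> \<union> (\<tau> \<inter> I k \<times> I k) \<in> Cong ?M"
      proof (rule cong_on_ideal[OF \<sigma> \<tau> sub])
        fix a b assume "(a, b) \<in> \<sigma>" "a \<in> I k"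
        then show "b \<in> I k"
          unfolding I_def using Cong_sym[OF \<sigma>] Cong_trans[OF \<sigma>] by blast
      next
        fix a c assume "a \<in> I k" and c: "c \<in> carrier ?M"
        then obtain m \<gamma> where a: "(a, (m + k, \<gamma>)) \<in> \<sigma>"
          unfolding I_def by blast
        obtain l \<delta> where l: "c = (l, \<delta>)"
          by (cases c)
        have "(a \<otimes>\<^bsub>?M\<^esub> c, (m + k, \<gamma>) \<otimes>\<^bsub>?M\<^esub> (l, \<delta>)) \<in> \<sigma>"
          "(c \<otimes>\<^bsub>?M\<^esub> a, (l, \<delta>) \<otimes>\<^bsub>?M\<^esub> (m + k, \<gamma>)) \<in> \<sigma>"
          using Cong_mult[OF \<sigma> a Cong_refl[OF \<sigma> c]] Cong_mult[OF \<sigma> Cong_refl[OF \<sigma> c] a]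
          unfolding l by blast+
        moreover have "m + k + l + Phi n \<gamma> \<delta> = (m + l + Phi n \<gamma> \<delta>) + k"
          "l + (m + k) + Phi n \<delta> \<gamma> = (l + m + Phi n \<delta> \<gamma>) + k"
          by simp_all
        ultimately show "a \<otimes>\<^bsub>?M\<^esub> c \<in> I k \<and> c \<otimes>\<^bsub>?M\<^esub> a \<in> I k"
          unfolding I_def mult_twisted by (metis (mono_tags, lifting) mem_Collect_eq)
      qed
      \<comment> \<open>This shifted pair is outside \<sigma>, so the new congruence is strictly
        above \<sigma> and the covering relation forces it to be \<tau>.\<close>
      moreover have "((i + k, \<alpha>), (j + k, \<beta>)) \<in> \<sigma> \<union> (\<tau> \<inter> I k \<times> I k)"
      proof -
        have "((i + k, \<alpha>), (j + k, \<beta>)) \<in> \<tau>"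
          using Cong_shift[OF \<tau> ab(1)] .
        moreover from this have "((i + k, \<alpha>), (i + k, \<alpha>)) \<in> \<sigma>" "((j + k, \<beta>), (j + k, \<beta>)) \<in> \<sigma>"
          using Cong_carrier[OF \<tau>] Cong_refl[OF \<sigma>] by blast+
        ultimately show ?thesis
          unfolding I_def by blast
      qed
      ultimately have "\<sigma> \<union> (\<tau> \<inter> I k \<times> I k) \<in> Cong ?M" "\<sigma> < \<sigma> \<union> (\<tau> \<inter> I k \<times> I k)"
        using False by blast+
      then have "\<not> \<sigma> \<union> (\<tau> \<inter> I k \<times> I k) < \<tau>"
        using cov by (auto simp: covers_def)
      then show ?thesis
        using sub by blast
    qed
    \<comment> \<open>Such an element is \<sigma>-related to elements with arbitrarily large first
      coordinate, while only finitely many partitions are available as second coordinate.\<close>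
    have per: "periodic \<sigma> \<delta>" if a: "\<And>k. (l, \<delta>) \<in> I k" for l \<delta>
    proof -
      have "\<exists>m \<gamma>. ((l, \<delta>), (m + k, \<gamma>)) \<in> \<sigma>" for k
        using a unfolding I_def by blast
      then obtain m \<gamma> where m: "\<And>k. ((l, \<delta>), (m k + k, \<gamma> k)) \<in> \<sigma>"
        by metis
      have "range \<gamma> \<subseteq> partitions n"
        using Cong_carrier[OF \<sigma> m] by (auto simp: carrier_twisted)
      then have "finite (range \<gamma>)"
        using finite_partitions finite_subset by blast
      then obtain k0 where "infinite {k. \<gamma> k = \<gamma> k0}"
        using pigeonhole_infinite[of UNIV \<gamma>] by auto
      \<comment> \<open>The bound on \<open>k1\<close> makes the indices \<open>m k0 + k0\<close>
        and \<open>m k1 + k1\<close> different.\<close>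
      then obtain k1 where k1: "k1 > m k0 + k0" "\<gamma> k1 = \<gamma> k0"
        unfolding infinite_nat_iff_unbounded by blast
      then have "((m k0 + k0, \<gamma> k0), (m k1 + k1, \<gamma> k0)) \<in> \<sigma>"
        using Cong_trans[OF \<sigma> Cong_sym[OF \<sigma> m[of k0]] m[of k1]] by simp
      then have "periodic \<sigma> (\<gamma> k0)"
        using periodicI[OF \<sigma>] k1(1) by (metis add.commute less_irrefl trans_less_add1)
      then show ?thesis
        using periodic_transfer[OF \<sigma> Cong_sym[OF \<sigma> m[of k0]]] by blast
    qed
    have "(i, \<alpha>) \<in> I k" "(j, \<beta>) \<in> I k" for k
      using whole[of k] ab by blast+
    then have "periodic \<sigma> \<alpha>" "periodic \<sigma> \<beta>"
      using per by blast+
    then show ?thesis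
      using ab by (metis snd_conv)
  qed
qed

text \<open>Each cover is sent to the pair of \<sigma>-classes of a pair from
  \<open>cover_pair\<close>. As a cover contains \<sigma>, it contains all representatives of that
  pair of classes, so \<open>covers_Cong_unique\<close> makes the map injective.\<close>

lemma finite_covers:
  assumes \<sigma>: "\<sigma> \<in> Cong (twisted_partition_monoid n)"
  shows "finite {\<tau>. covers (Cong (twisted_partition_monoid n)) \<tau> \<sigma>}" (is "finite ?T")
proof -
  define cl where "cl = (\<lambda>a. \<sigma> `` {a})"
  define K where "K = {\<sigma> `` {(i, \<alpha>)} | i \<alpha>. \<alpha> \<in> partitions n \<and> periodic \<sigma> \<alpha>}"
  define S where "S = map_prod cl cl ` last_pairs \<sigma> \<union> K \<times> K"
  have "\<exists>x \<in> S. \<exists>a b. x = (cl a, cl b) \<and> (a, b) \<in> \<tau> \<and> (a, b) \<notin> \<sigma>" if T: "\<tau> \<in> ?T" for \<tau>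
  proof -
    have \<tau>: "\<tau> \<in> Cong (twisted_partition_monoid n)"
      using T unfolding covers_def by blast
    obtain a b where ab: "(a, b) \<in> \<tau>" "(a, b) \<notin> \<sigma>"
      "(a, b) \<in> last_pairs \<sigma> \<or> (periodic \<sigma> (snd a) \<and> periodic \<sigma> (snd b))"
      using cover_pair[of n \<tau> \<sigma>] T by blast
    have "snd a \<in> partitions n" "snd b \<in> partitions n"
      using Cong_carrier[OF \<tau> ab(1)] by (metis carrier_twisted prod.collapse)+
    then have "cl a \<in> K \<and> cl b \<in> K" if "periodic \<sigma> (snd a)" "periodic \<sigma> (snd b)"
      using that unfolding cl_def K_def by (cases a; cases b) auto
    then have "(cl a, cl b) \<in> S"
      using ab(3) unfolding S_def by force
    then show ?thesis
      using ab by blast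
  qed
  then obtain f where f: "\<And>\<tau>. \<tau> \<in> ?T \<Longrightarrow> f \<tau> \<in> S"
    "\<And>\<tau>. \<tau> \<in> ?T \<Longrightarrow> \<exists>a b. f \<tau> = (cl a, cl b) \<and> (a, b) \<in> \<tau> \<and> (a, b) \<notin> \<sigma>"
    by metis
  have "inj_on f ?T"
  proof (rule inj_onI)
    fix \<tau> \<tau>' assume T: "\<tau> \<in> ?T" "\<tau>' \<in> ?T" and eq: "f \<tau> = f \<tau>'"
    obtain a b where ab: "f \<tau> = (cl a, cl b)" "(a, b) \<in> \<tau>" "(a, b) \<notin> \<sigma>"
      using f(2)[OF T(1)] by blast
    obtain a' b' where ab': "f \<tau>' = (cl a', cl b')" "(a', b') \<in> \<tau>'"
      using f(2)[OF T(2)] by blast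
    have \<tau>: "\<tau> \<in> Cong (twisted_partition_monoid n)"
      and \<tau>': "\<tau>' \<in> Cong (twisted_partition_monoid n)" and sub: "\<sigma> \<subseteq> \<tau>'"
      using T unfolding covers_def by auto
    have "a \<in> cl a" "b \<in> cl b"
      using Cong_carrier[OF \<tau> ab(2)] Cong_refl[OF \<sigma>] unfolding cl_def by blast+
    then have "(a', a) \<in> \<sigma>" "(b', b) \<in> \<sigma>"
      using eq ab(1) ab'(1) unfolding cl_def by auto
    then have "(a, b) \<in> \<tau>'"
      using ab'(2) sub Cong_sym[OF \<tau>'] Cong_trans[OF \<tau>'] by blast
    then show "\<tau> = \<tau>'"
      using covers_Cong_unique T ab by blast
  qed
  moreover have "finite S"
    using finite_last_pairs[OF \<sigma>] finite_periodic_classes[OF \<sigma>] unfolding S_def K_def by blast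
  ultimately show ?thesis
    using f(1) by (meson image_subsetI inj_on_finite)
qed

section \<open>Partitions without transversals\<close>

definition rank_zero :: "nat \<Rightarrow> vertex set set set" where
  "rank_zero n = {\<alpha> \<in> partitions n. \<forall>x y. \<not> same_block \<alpha> (Up x) (Lo y)}"

lemma rank_zero_nonempty: "rank_zero n \<noteq> {}"
proof -
  have "(\<lambda>x. {x}) ` boundary n \<in> rank_zero n"
    unfolding rank_zero_def partitions_def partition_on_def disjoint_def same_block_def by auto
  then show ?thesis
    by blast
qed

text \<open>A path starting in the upper row never leaves it: edges from \<beta> do not touch upper
  vertices, and edges from \<alpha> would need a transversal to go down.\<close>

lemma prod_left_rank_zero_path:
  assumes \<alpha>: "\<alpha> \<in> rank_zero n" and "(Up x, v) \<in> (product_edges \<alpha> \<beta>)\<^sup>*" "x \<in> {1..n}"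
  shows "\<exists>y. v = Up y \<and> same_block \<alpha> (Up x) (Up y)"
  using assms(2)
proof induction
  case base
  then show ?case
    using \<alpha> assms(3) same_block_refl by (auto simp: rank_zero_def boundary_def)
next
  case (step v w)
  then obtain y where y: "v = Up y" "same_block \<alpha> (Up x) (Up y)"
    by blast
  from step(2) show ?case
  proof (cases rule: product_edgesE)
    case (1 a b)
    have a: "a = Up y"
      using 1(1) y(1) by (cases a) auto
    then obtain z where "b = Up z"
      using 1(3) \<alpha> same_block_in[of \<alpha> n a b] by (auto simp: rank_zero_def boundary_def)
    then show ?thesis
      using 1 y a \<alpha> same_block_trans by (auto simp: rank_zero_def)
  next
    case (2 a b)
    then show ?thesis
      using y(1) by (cases a) auto
  qed
qed

lemma prod_right_rank_zero_path:
  assumes \<beta>: "\<beta> \<in> rank_zero n" and "(Lo x, v) \<in> (product_edges \<alpha> \<beta>)\<^sup>*" "x \<in> {1..n}"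
  shows "\<exists>y. v = Lo y \<and> same_block \<beta> (Lo x) (Lo y)"
  using assms(2)
proof induction
  case base
  then show ?case
    using \<beta> assms(3) same_block_refl by (auto simp: rank_zero_def boundary_def)
next
  case (step v w)
  then obtain y where y: "v = Lo y" "same_block \<beta> (Lo x) (Lo y)"
    by blast
  from step(2) show ?case
  proof (cases rule: product_edgesE)
    case (1 a b)
    then show ?thesis
      using y(1) by (cases a) auto
  next
    case (2 a b)
    have a: "a = Lo y"
      using 2(1) y(1) by (cases a) auto
    then obtain z where "b = Lo z"
      using 2(3) \<beta> same_block_in[of \<beta> n a b] same_block_sym[OF 2(3)]
      by (auto simp: rank_zero_def boundary_def)
    then show ?thesis
      using 2 y a \<beta> same_block_trans by (auto simp: rank_zero_def)
  qed
qed

lemma same_block_prod_Up: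
  assumes "\<alpha> \<in> rank_zero n" "x \<in> {1..n}" "y \<in> {1..n}"
  shows "same_block (partition_prod n \<alpha> \<beta>) (Up x) (Up y) \<longleftrightarrow> same_block \<alpha> (Up x) (Up y)"
proof -
  have "Up x \<in> boundary n" "Up y \<in> boundary n"
    using assms by (auto simp: boundary_def)
  then show ?thesis
    using same_block_prod[of "Up x" n "Up y" \<alpha> \<beta>]
      prod_left_rank_zero_path[OF assms(1) _ assms(2), of "Up y" \<beta>]
      product_edges_left[of \<alpha> "Up x" "Up y" \<beta>] by auto
qed

lemma same_block_prod_Lo:
  assumes "\<beta> \<in> rank_zero n" "x \<in> {1..n}" "y \<in> {1..n}"
  shows "same_block (partition_prod n \<alpha> \<beta>) (Lo x) (Lo y) \<longleftrightarrow> same_block \<beta> (Lo x) (Lo y)"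
proof -
  have "Lo x \<in> boundary n" "Lo y \<in> boundary n"
    using assms by (auto simp: boundary_def)
  then show ?thesis
    using same_block_prod[of "Lo x" n "Lo y" \<alpha> \<beta>]
      prod_right_rank_zero_path[OF assms(1) _ assms(2), of "Lo y" \<alpha>]
      product_edges_right[of \<beta> "Lo x" "Lo y" \<alpha>] by auto
qed

lemma rank_zero_ideal:
  assumes "\<alpha> \<in> rank_zero n \<or> \<beta> \<in> rank_zero n"
  shows "partition_prod n \<alpha> \<beta> \<in> rank_zero n"
proof -
  have False if b: "same_block (partition_prod n \<alpha> \<beta>) (Up x) (Lo y)" for x y
  proof -
    have bd: "Up x \<in> boundary n" "Lo y \<in> boundary n"
      using same_block_in[OF partition_prod_closed b] by blast+
    then have xy: "x \<in> {1..n}" "y \<in> {1..n}"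
      by (auto simp: boundary_def)
    have "(Up x, Lo y) \<in> (product_edges \<alpha> \<beta>)\<^sup>*" "(Lo y, Up x) \<in> (product_edges \<alpha> \<beta>)\<^sup>*"
      using same_block_prod bd b same_block_sym[OF b] by blast+
    then show False
      using assms prod_left_rank_zero_path[of \<alpha> n x "Lo y" \<beta>]
        prod_right_rank_zero_path[of \<beta> n y "Up x" \<alpha>] xy by auto
  qed
  then show ?thesis
    using partition_prod_closed by (auto simp: rank_zero_def)
qed

text \<open>The upper blocks come from the left factor \<beta>, the lower blocks from
  \<alpha>\<beta> and hence again from \<beta>, and neither side has transversals.\<close>

lemma rank_zero_sandwich:
  assumes "\<beta> \<in> rank_zero n"
  shows "partition_prod n \<beta> (partition_prod n \<alpha> \<beta>) = \<beta>" (is "?p = _")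
proof (rule partitions_eqI[OF partition_prod_closed])
  show "\<beta> \<in> partitions n"
    using assms by (simp add: rank_zero_def)
  have \<alpha>\<beta>: "partition_prod n \<alpha> \<beta> \<in> rank_zero n" and p: "?p \<in> rank_zero n"
    using rank_zero_ideal assms by blast+
  fix x y assume "x \<in> boundary n" "y \<in> boundary n"
  then show "same_block ?p x y \<longleftrightarrow> same_block \<beta> x y"
    using p assms same_block_prod_Up[OF assms] same_block_prod_Lo[OF \<alpha>\<beta>] same_block_prod_Lo[OF assms]
    by (auto elim!: boundary_cases simp: rank_zero_def dest: same_block_sym)
qed

section \<open>A congruence covering infinitely many congruences\<close>

definition theta :: "nat \<Rightarrow> nat \<Rightarrow> (nat \<times> vertex set set) rel" where
  "theta n d = {((i, \<alpha>), (j, \<alpha>)) | i j \<alpha>.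
     \<alpha> \<in> partitions n \<and> (i = j \<or> (\<alpha> \<in> rank_zero n \<and> i mod d = j mod d))}"

lemma theta_iff:
  "((i, \<alpha>), (j, \<beta>)) \<in> theta n d \<longleftrightarrow>
    \<alpha> = \<beta> \<and> \<alpha> \<in> partitions n \<and> (i = j \<or> (\<alpha> \<in> rank_zero n \<and> i mod d = j mod d))"
  unfolding theta_def by auto

text \<open>\<open>Phi\<close> depends only on the partitions, which agree within each related pair,
  so residues modulo \<open>d\<close> are respected; unequal indices occur only over the ideal
  \<open>rank_zero n\<close>.\<close>

lemma theta_Cong: "theta n d \<in> Cong (twisted_partition_monoid n)"
proof -
  let ?M = "twisted_partition_monoid n"
  have "equiv (carrier ?M) (theta n d)"
  proof (rule equivI)
    show "theta n d \<subseteq> carrier ?M \<times> carrier ?M" "refl_on (carrier ?M) (theta n d)"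
      by (auto simp: theta_def carrier_twisted refl_on_def)
    show "sym (theta n d)" "trans (theta n d)"
      by (auto simp: theta_def sym_def trans_def)
  qed
  moreover have "(a \<otimes>\<^bsub>?M\<^esub> c, b \<otimes>\<^bsub>?M\<^esub> e) \<in> theta n d"
    if ab: "(a, b) \<in> theta n d" and ce: "(c, e) \<in> theta n d" for a b c e
  proof -
    obtain i i' \<alpha> where 1: "a = (i, \<alpha>)" "b = (i', \<alpha>)"
      "i = i' \<or> (\<alpha> \<in> rank_zero n \<and> i mod d = i' mod d)"
      using ab unfolding theta_def by blast
    obtain j j' \<beta> where 2: "c = (j, \<beta>)" "e = (j', \<beta>)"
      "j = j' \<or> (\<beta> \<in> rank_zero n \<and> j mod d = j' mod d)"
      using ce unfolding theta_def by blast
    have "i mod d = i' mod d" "j mod d = j' mod d"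
      using 1 2 by auto
    then have "(i + j + Phi n \<alpha> \<beta>) mod d = (i' + j' + Phi n \<alpha> \<beta>) mod d"
      by (intro mod_add_cong refl)
    then show ?thesis
      using 1 2 rank_zero_ideal[of \<alpha> n \<beta>] unfolding 1 2 mult_twisted theta_iff
      by (auto simp: partition_prod_closed)
  qed
  ultimately show ?thesis
    unfolding Cong_def by blast
qed

lemma prime_mod_generates:
  fixes x y d p :: nat
  assumes "prime p" "\<not> p dvd d"
  shows "\<exists>k. (x + k * d) mod p = y mod p"
proof -
  have "coprime (int d) (int p)"
    using prime_imp_coprime[OF assms] by (simp add: coprime_commute)
  then obtain u where u: "[int d * u = 1] (mod int p)"
    using cong_solve_coprime_int by blast
  \<comment> \<open>The inverse \<open>u\<close> of \<open>d\<close> modulo \<open>p\<close> solves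
    the equation over the integers, where \<open>y - x\<close> may be negative; reducing modulo
    \<open>p\<close> makes the solution nonnegative before \<open>nat\<close> is applied.\<close>
  define k where "k = nat ((u * (int y - int x)) mod int p)"
  have "int p > 0"
    using assms(1) prime_gt_0_nat by simp
  then have "[int k = u * (int y - int x)] (mod int p)"
    by (simp add: k_def cong_def)
  then have "[int x + int k * int d = int x + u * (int y - int x) * int d] (mod int p)"
    by (intro cong_add cong_mult cong_refl)
  also have "int x + u * (int y - int x) * int d = int x + int d * u * (int y - int x)"
    by (simp add: algebra_simps)
  also have "[int x + int d * u * (int y - int x) = int x + 1 * (int y - int x)] (mod int p)"
    by (intro cong_add cong_mult cong_refl u)
  finally have "[int (x + k * d) = int y] (mod int p)"
    by simp
  then have "(x + k * d) mod p = y mod p"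
    unfolding cong_int_iff by (simp add: cong_def)
  then show ?thesis
    by blast
qed

text \<open>A congruence strictly between would relate two indices of different residue over one
  \<alpha>. Sandwiching moves their difference to every \<beta> in \<open>rank_zero n\<close>, and
  this difference generates the residues modulo the prime \<open>p\<close>.\<close>

lemma theta_covers:
  assumes p: "prime p"
  shows "covers (Cong (twisted_partition_monoid n)) (theta n 1) (theta n p)"
proof -
  let ?M = "twisted_partition_monoid n"
  have sub: "theta n p \<subseteq> theta n 1"
    unfolding theta_def by auto
  obtain \<alpha> where "\<alpha> \<in> rank_zero n"
    using rank_zero_nonempty by blast
  moreover have "p \<noteq> 1" "1 mod p = 1"
    using p prime_gt_1_nat[OF p] by auto
  ultimately have "((0, \<alpha>), (1, \<alpha>)) \<in> theta n 1 - theta n p"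
    by (auto simp: theta_iff rank_zero_def)
  then have strict: "theta n p < theta n 1"
    using sub by blast
  moreover have "\<rho> = theta n 1"
    if \<rho>: "\<rho> \<in> Cong ?M" and lo: "theta n p < \<rho>" and hi: "\<rho> \<subseteq> theta n 1" for \<rho>
  proof -
    obtain x where x: "x \<in> \<rho>" "x \<notin> theta n p"
      using lo by blast
    then have "x \<in> theta n 1"
      using hi by blast
    then obtain i j \<alpha> where x': "x = ((i, \<alpha>), (j, \<alpha>))" "\<alpha> \<in> rank_zero n" "i mod p \<noteq> j mod p"
      using x unfolding theta_def by auto
    have "\<exists>i j. i < j \<and> i mod p \<noteq> j mod p \<and> ((i, \<alpha>), (j, \<alpha>)) \<in> \<rho>"
      using x x' Cong_sym[OF \<rho>] by (metis nat_neq_iff)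
    then obtain i j where ij: "i < j" "i mod p \<noteq> j mod p" "((i, \<alpha>), (j, \<alpha>)) \<in> \<rho>"
      by blast
    have "((a, \<beta>), (b, \<beta>)) \<in> \<rho>" if \<beta>: "\<beta> \<in> rank_zero n" for a b \<beta>
    proof -
      define d where "d = j - i"
      have d: "\<not> p dvd d"
        using ij(1,2) mod_eq_dvd_iff_nat[of i j p] unfolding d_def by fastforce
      have "\<beta> \<in> partitions n"
        using \<beta> by (simp add: rank_zero_def)
      then have r: "((0, \<beta>), (0, \<beta>)) \<in> \<rho>"
        using Cong_refl[OF \<rho>] by (simp add: carrier_twisted)
      \<comment> \<open>The first coordinate of \<open>(0, \<beta>)\<close> times the product of
        \<open>(i, \<alpha>)\<close> and \<open>(0, \<beta>)\<close>. The same \<open>Phi\<close>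
        terms arise from \<open>j\<close>, so the difference \<open>d\<close> survives.\<close>
      define c where "c = i + Phi n \<alpha> \<beta> + Phi n \<beta> (partition_prod n \<alpha> \<beta>)"
      have "((c, \<beta>), (j + Phi n \<alpha> \<beta> + Phi n \<beta> (partition_prod n \<alpha> \<beta>), \<beta>)) \<in> \<rho>"
        using Cong_mult[OF \<rho> r Cong_mult[OF \<rho> ij(3) r]]
        by (simp add: mult_twisted rank_zero_sandwich[OF \<beta>] c_def)
      moreover have "j + Phi n \<alpha> \<beta> + Phi n \<beta> (partition_prod n \<alpha> \<beta>) = c + d"
        using ij(1) unfolding c_def d_def by simp
      ultimately have step: "((c, \<beta>), (c + d, \<beta>)) \<in> \<rho>"
        by simp
      \<comment> \<open>These pairs come from the inclusion of \<open>theta n p\<close> in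
        \<rho>.\<close>
      have mods: "((u, \<beta>), (v, \<beta>)) \<in> \<rho>" if "u mod p = v mod p" for u v
        using that lo \<beta> \<open>\<beta> \<in> partitions n\<close> theta_iff[of u \<beta> v \<beta> n p] by blast
      have multiples: "((c + l, \<beta>), (c + l + k * d, \<beta>)) \<in> \<rho>" for k l
      proof (induction k)
        case 0
        then show ?case
          using mods by simp
      next
        case (Suc k)
        have "((c + l + k * d, \<beta>), (c + l + Suc k * d, \<beta>)) \<in> \<rho>"
          using Cong_shift[OF \<rho> step, of "l + k * d"] by (simp add: algebra_simps)
        then show ?case
          using Suc Cong_trans[OF \<rho>] by blast
      qed
      \<comment> \<open>The classes below \<open>c\<close> are reached through the period \<open>p\<close>.\<close>
      obtain k where k: "(c + a * p + k * d) mod p = b mod p"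
        using prime_mod_generates[OF p d] by blast
      obtain k' where k': "(c + k' * d) mod p = a mod p"
        using prime_mod_generates[OF p d] by blast
      have "((c + 0, \<beta>), (c + 0 + k' * d, \<beta>)) \<in> \<rho>" "((c + a * p, \<beta>), (c + a * p + k * d, \<beta>)) \<in> \<rho>"
        using multiples by blast+
      moreover have "((c + 0 + k' * d, \<beta>), (a, \<beta>)) \<in> \<rho>" "((c + a * p + k * d, \<beta>), (b, \<beta>)) \<in> \<rho>"
        "((c + 0, \<beta>), (c + a * p, \<beta>)) \<in> \<rho>"
        using mods k k' by simp_all
      ultimately show ?thesis
        using Cong_sym[OF \<rho>] Cong_trans[OF \<rho>] by meson
    qed
    then have "theta n 1 \<subseteq> \<rho>"
      using Cong_refl[OF \<rho>] unfolding theta_def by (auto simp: carrier_twisted)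
    then show ?thesis
      using hi by blast
  qed
  ultimately show ?thesis
    using theta_Cong unfolding covers_def by blast
qed

text \<open>Over a partition without transversals, the indices identified with 0 are the multiples
  of the modulus; for primes, divisibility then forces equality.\<close>

lemma inj_on_theta: "inj_on (theta n) {p. prime p}"
proof (rule inj_onI)
  fix p q :: nat assume pq: "p \<in> {p. prime p}" "q \<in> {p. prime p}" "theta n p = theta n q"
  obtain \<alpha> where "\<alpha> \<in> rank_zero n"
    using rank_zero_nonempty by blast
  then have "((0, \<alpha>), (p, \<alpha>)) \<in> theta n p"
    by (simp add: theta_iff rank_zero_def)
  then have "q dvd p"
    using pq by (auto simp: theta_iff)
  then show "p = q"
    using pq primes_dvd_imp_eq by auto
qed

theorem theorem4p4:
  fixes n :: nat
  assumes "n \<ge> 1"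
  shows "(\<forall>\<sigma>\<in>Cong (twisted_partition_monoid n).
            finite {\<tau>. covers (Cong (twisted_partition_monoid n)) \<tau> \<sigma>}) \<and>
         (\<exists>\<tau>\<in>Cong (twisted_partition_monoid n).
            infinite {\<sigma>. covers (Cong (twisted_partition_monoid n)) \<tau> \<sigma>})"
proof (intro conjI ballI bexI)
  show "finite {\<tau>. covers (Cong (twisted_partition_monoid n)) \<tau> \<sigma>}"
    if "\<sigma> \<in> Cong (twisted_partition_monoid n)" for \<sigma>
    using finite_covers[OF that] .
  have "infinite (theta n ` {p. prime p})"
    using inj_on_theta primes_infinite finite_imageD by blast
  moreover have "theta n ` {p. prime p} \<subseteq>
      {\<sigma>. covers (Cong (twisted_partition_monoid n)) (theta n 1) \<sigma>}"
    using theta_covers by blast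
  ultimately show "infinite {\<sigma>. covers (Cong (twisted_partition_monoid n)) (theta n 1) \<sigma>}"
    using finite_subset by blast
  show "theta n 1 \<in> Cong (twisted_partition_monoid n)"
    by (rule theta_Cong)
qed

end
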